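(* Let $X$ be a uniform space with uniformity $\mathcal{U}$. If $X$ admits a topologically expansive homeomorphism $f:X\to X$, then $X$ is a regular space.
   Context: A uniform space $(X,\mathcal{U})$ carries the topology in which a set $T\subseteq X$ is open iff for every $x\in T$ there is $U\in\mathcal{U}$ with $U[x]=\{y : (x,y)\in U\}\subseteq T$; topological terms refer to this topology. Members of $\mathcal{U}$ are called entourages. For an entourage $D\in\mathcal{U}$, a homeomorphism $f:X\to X$ and $x\in X$, let $\Gamma_D(x,f)=\{y\in X : (f^n(x),f^n(y))\in D \text{ for all } n\in\mathbb{Z}\}$. A homeomorphism $f:X\to X$ is topologically expansive if there exists an entourage $A\in\mathcal{U}$ such that $\Gamma_A(x,f)=\{x\}$ for every $x\in X$. Convention: "regular" includes the $T_1$ axiom (i.e. regular Hausdorff, $T_3$). *)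

theory Defs
  imports "HOL-Analysis.Analysis"
begin

definition entourage :: "('a::uniform_space \<times> 'a) set \<Rightarrow> bool" where
  "entourage D \<longleftrightarrow> (\<forall>\<^sub>F p in uniformity. p \<in> D)"

text \<open>Integer iterates; \<^term>\<open>inv f\<close> is the two-sided inverse only when \<^term>\<open>f\<close> is bijective,
  so negative exponents are meaningful only in that case.\<close>

definition int_iterate :: "('a \<Rightarrow> 'a) \<Rightarrow> int \<Rightarrow> 'a \<Rightarrow> 'a" where
  "int_iterate f n = (if n \<ge> 0 then f ^^ nat n else inv f ^^ nat (- n))"

definition Gamma_ball :: "('a \<times> 'a) set \<Rightarrow> 'a \<Rightarrow> ('a \<Rightarrow> 'a) \<Rightarrow> 'a set" where
  "Gamma_ball D x f = {y. \<forall>n::int. (int_iterate f n x, int_iterate f n y) \<in> D}"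

definition topologically_expansive :: "('a::uniform_space \<Rightarrow> 'a) \<Rightarrow> bool" where
  "topologically_expansive f \<longleftrightarrow> (\<exists>A. entourage A \<and> (\<forall>x. Gamma_ball A x f = {x}))"

end

theory Submission
  imports Defs
begin

text \<open>
  Regularity uses only the uniformity: if \<open>D\<close> is a half-size entourage, \<open>D \<circ> D \<subseteq> E\<close>, then the
  closure of \<open>D[a]\<close> lies in \<open>E[a]\<close>, so every point has a neighbourhood base of closed sets.
  Such a space may still fail to be \<open>T\<^sub>1\<close>, and this is where expansivity enters.
  For \<open>x \<noteq> y\<close> some iterate \<open>f\<^sup>n\<close> takes the pair out of the expansivity entourage \<open>A\<close>, so
  \<open>A[f\<^sup>n x]\<close> is a neighbourhood of \<open>f\<^sup>n x\<close> that misses \<open>f\<^sup>n y\<close>. Every integer iterate of a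
  homeomorphism is continuous, hence the neighbourhood pulls back to one of \<open>x\<close> that misses \<open>y\<close>.
\<close>

lemma eventually_nhds_entourage_section:
  assumes "entourage D"
  shows "\<forall>\<^sub>F y in nhds x. (x, y) \<in> D"
  unfolding eventually_nhds_uniformity
  by (rule eventually_mono[OF assms[unfolded entourage_def]]) auto

lemma regular_space_euclidean_uniform:
  "regular_space (euclidean :: 'a::uniform_space topology)"
  unfolding regular_space_def
proof (intro allI impI)
  fix C :: "'a set" and a :: 'a
  assume "closedin euclidean C \<and> a \<in> topspace euclidean - C"
  then have "open (- C)" "a \<in> - C"
    by auto
  then have "\<forall>\<^sub>F p in uniformity. case p of (x, y) \<Rightarrow> x = a \<longrightarrow> y \<in> - C"
    using open_uniformity by blast
  then obtain D where D: "eventually D uniformity"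
    and comp: "\<And>x y z. D (x, y) \<Longrightarrow> D (y, z) \<Longrightarrow> x = a \<longrightarrow> z \<in> - C"
    by (rule uniformity_transE) auto
  let ?V = "interior {y. D (a, y)}"
  have a: "a \<in> ?V"
    using eventually_nhds_entourage_section[of "Collect D" a] D
    unfolding entourage_def by (auto simp: eventually_nhds interior_def)
  have "y \<in> - closure ?V" if "y \<in> C" for y
  proof -
    \<comment> \<open>By symmetry of the uniformity, the points \<open>z\<close> with \<open>y \<in> D[z]\<close> form a neighbourhood of \<open>y\<close>.\<close>
    have "\<forall>\<^sub>F z in nhds y. D (z, y)"
      using eventually_nhds_entourage_section[of "{(u, v). D (v, u)}" y] uniformity_sym[OF D]
      unfolding entourage_def by (simp add: case_prod_unfold)
    then obtain W where W: "open W" "y \<in> W" "\<And>z. z \<in> W \<Longrightarrow> D (z, y)"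
      unfolding eventually_nhds by blast
    have "W \<inter> ?V = {}"
      using W(3) comp \<open>y \<in> C\<close> interior_subset[of "{y. D (a, y)}"] by blast
    then show ?thesis
      using open_Int_closure_eq_empty[OF W(1)] W(2) by blast
  qed
  with a show "\<exists>U V. openin euclidean U \<and> openin euclidean V \<and> a \<in> U \<and> C \<subseteq> V \<and> disjnt U V"
    using closure_subset[of ?V]
    by (intro exI[of _ ?V] exI[of _ "- closure ?V"]) (auto simp: disjnt_def)
qed

lemma continuous_on_funpow:
  fixes g :: "'a::topological_space \<Rightarrow> 'a"
  assumes "continuous_on UNIV g"
  shows "continuous_on UNIV (g ^^ n)"
proof (induction n)
  case 0
  show ?case by (simp add: id_def)
next
  case (Suc n)
  then show ?case
    using continuous_on_compose[OF Suc continuous_on_subset[OF assms subset_UNIV]] by simp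
qed

lemma continuous_on_int_iterate:
  fixes f :: "'a::topological_space \<Rightarrow> 'a"
  assumes "homeomorphic_map euclidean euclidean f"
  shows "continuous_on UNIV (int_iterate f n)"
proof -
  have bij: "bij f" and cont: "continuous_on UNIV f" and op: "open_map euclidean euclidean f"
    using assms homeomorphic_eq_everything_map[of euclidean euclidean f]
    by (auto simp: bij_def)
  have "inv f -` B = f ` B" for B
    using bij_vimage_eq_inv_image[OF bij_imp_bij_inv[OF bij]] inv_inv_eq[OF bij] by simp
  then have "continuous_on UNIV (inv f)"
    using op unfolding continuous_on_open_vimage[OF open_UNIV] open_map_def by simp
  with cont show ?thesis
    unfolding int_iterate_def by (simp add: continuous_on_funpow)
qed

lemma t1_space_if_expansive:
  fixes f :: "'a::uniform_space \<Rightarrow> 'a"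
  assumes cont: "\<And>n. continuous_on UNIV (int_iterate f n)"
    and "topologically_expansive f"
  shows "t1_space (euclidean :: 'a topology)"
  unfolding t1_space_def
proof (intro ballI impI)
  fix x y :: 'a
  assume "x \<noteq> y"
  obtain A where A: "entourage A" "\<And>x. Gamma_ball A x f = {x}"
    using assms(2) unfolding topologically_expansive_def by blast
  have "y \<notin> Gamma_ball A x f"
    using A(2) \<open>x \<noteq> y\<close> by simp
  then obtain n where n: "(int_iterate f n x, int_iterate f n y) \<notin> A"
    unfolding Gamma_ball_def by blast
  obtain W where W: "open W" "int_iterate f n x \<in> W" "\<And>z. z \<in> W \<Longrightarrow> (int_iterate f n x, z) \<in> A"
    using eventually_nhds_entourage_section[OF A(1), of "int_iterate f n x"] unfolding eventually_nhds by blast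
  have "open (int_iterate f n -` W)"
    using open_vimage[OF W(1) cont] .
  then show "\<exists>U. openin euclidean U \<and> x \<in> U \<and> y \<notin> U"
    using W n by (intro exI[of _ "int_iterate f n -` W"]) auto
qed

theorem corollary3p7:
  fixes f :: "'a::uniform_space \<Rightarrow> 'a"
  assumes "homeomorphic_map euclidean euclidean f"
    and "topologically_expansive f"
  shows "regular_space (euclidean :: 'a topology) \<and> t1_space (euclidean :: 'a topology)"
  using regular_space_euclidean_uniform
    t1_space_if_expansive[OF continuous_on_int_iterate[OF assms(1)] assms(2)]
  by blast

end
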